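(* Let $k\ge 2$ systems be subject to $s$ probability constraints, let $1-\alpha\in(0,1)$ be the nominal confidence level, let $\theta_\ell>1$ for $\ell=1,\dots,s$, and let $T_\ell^{(1)}=\{h_{\ell,1}^{(1)}<\dots<h_{\ell,d_\ell^{(1)}}^{(1)}\}\subset(0,1)$ be the finite set of first-pass thresholds on constraint $\ell$. Suppose the $k$ systems produce Bernoulli observations as described in the context, either simulated independently or with common random numbers (CRN), with $\beta$ set correspondingly, and with $(\beta_\ell)_{\ell=1}^s$ set by either choice (i) or choice (ii) of the context. Then the first-pass procedure $\mathcal{BRF}^{(1)}$ guarantees $$\mathrm{PCD}=\Pr\Big(\bigcap_{i=1}^k\bigcap_{\ell=1}^s\bigcap_{h\in T_\ell^{(1)}}\mathrm{CD}_{i\ell}(h)\Big)\ \ge\ 1-\alpha .$$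
   Context: Data. For each system $i\in\{1,\dots,k\}$, the vectors $(Y_{i1n},\dots,Y_{isn})$, $n=1,2,\dots$, are independent and identically distributed in $n$, and $Y_{i\ell n}\in\{0,1\}$ is Bernoulli distributed with success probability $p_{i\ell}$. Dependence between $Y_{i\ell n}$ and $Y_{i\ell' n}$ for $\ell\ne\ell'$ (same $i,n$) is allowed. For each system $i$, $U_{i1},U_{i2},\dots$ are i.i.d. uniform on $(0,1)$, independent of the observations $(Y_{i\ell n})_{\ell,n}$ of system $i$. For a threshold $h\in(0,1)$ the dummy Bernoulli variables are $I_{in}(h)=1$ if $U_{in}\le h$ and $0$ otherwise (the same $U_{in}$ is used for all thresholds and all constraints). Two sampling modes. Independent simulation: the families $\big((Y_{i\ell n})_{\ell,n},(U_{in})_n\big)$ are independent across $i$; then $\beta=1-(1-\alpha)^{1/k}$. CRN: the families may be dependent across systems $i$ (for instance $U_{in}=U_n$ for all $i$ is allowed); then $\beta=\alpha/k$. Error allocation. $d_\ell^{(u)}$ is the number of thresholds considered on constraint $\ell$ in pass $u$, where $w\ge1$ passes in total are performed, and $N_\ell=\sum_{u=1}^w d_\ell^{(u)}$. Either (i) $\beta_\ell=\beta/s$ if $N_\ell=1$ and $\beta_\ell=\beta/(2s)$ if $N_\ell>1$; or (ii) $\beta_\ell=\beta/D$ for all $\ell$, with $D=\sum_{\ell=1}^s\min\{N_\ell,2\}$. $H_\ell$ is the smallest integer such that $\beta_\ell\ge 1/(1+\theta_\ell^{H_\ell})$. ($\beta_\ell$ and $H_\ell$ are only used for constraints with $T_\ell^{(1)}\neq\emptyset$;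 an intersection over an empty threshold set is the whole sample space.) Procedure $\mathcal{BRF}^{(1)}$. For each $i$, $\ell$ and $h\in T_\ell^{(1)}$, consider $S_{i\ell}(r;h)=\sum_{n=1}^r\big(Y_{i\ell n}-I_{in}(h)\big)$, $r=1,2,\dots$. Sampling continues until the first $r$ at which $S_{i\ell}(r;h)\le -H_\ell$ or $S_{i\ell}(r;h)\ge H_\ell$. At that $r$, system $i$ is declared feasible for $h$ on constraint $\ell$ if $S_{i\ell}(r;h)\le-H_\ell$, and otherwise (that is, if $S_{i\ell}(r;h)\ge H_\ell$) it is declared infeasible. Correct decision. System $i$ is desirable for $h$ on constraint $\ell$ if $\frac{(1-p_{i\ell})h}{p_{i\ell}(1-h)}\ge\theta_\ell$, unacceptable if $\frac{p_{i\ell}(1-h)}{(1-p_{i\ell})h}\ge\theta_\ell$, and acceptable otherwise. $\mathrm{CD}_{i\ell}(h)$ is the correct decision event: system $i$ is declared feasible for $h$ on constraint $\ell$ if it is desirable, and is declared infeasible if it is unacceptable; if it is acceptable, any decision is considered correct.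
   Formalization: H_ℓ is taken to be the smallest positive integer with β_ℓ ≥ 1/(1+θ_ℓ^{H_ℓ}); this agrees with the smallest integer when β_ℓ < 1/2, while for β_ℓ ≥ 1/2 the smallest integer is nonpositive and the guarantee can fail. *)

theory Defs
  imports "HOL-Probability.Probability"
begin

subsection \<open>Data\<close>

definition iid_vars :: "'a measure \<Rightarrow> 'b measure \<Rightarrow> ('i \<Rightarrow> 'a \<Rightarrow> 'b) \<Rightarrow> 'i set \<Rightarrow> bool" where
  "iid_vars M N X I \<longleftrightarrow>
     prob_space.indep_vars M (\<lambda>_. N) X I \<and>
     (\<forall>i\<in>I. \<forall>j\<in>I. distr M N (X i) = distr M N (X j))"

text \<open>
  Independence of two random variables whose value types may differ, which \<open>indep_var\<close> does not allow.
\<close>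

definition indep_pair ::
    "'a measure \<Rightarrow> 'b measure \<Rightarrow> ('a \<Rightarrow> 'b) \<Rightarrow> 'c measure \<Rightarrow> ('a \<Rightarrow> 'c) \<Rightarrow> bool" where
  "indep_pair M N X N' X' \<longleftrightarrow>
     X \<in> measurable M N \<and> X' \<in> measurable M N' \<and>
     prob_space.indep_set M
       {X -` A \<inter> space M | A. A \<in> sets N} {X' -` A \<inter> space M | A. A \<in> sets N'}"

text \<open>
  Observations are Boolean, with \<^term>\<open>True\<close> for the value 1 and \<^term>\<open>False\<close> for the value 0.
  Systems, constraints and observations are numbered from 1.
  In the three functions below, \<open>Y l n\<close> and \<open>U n\<close> belong to one fixed system, and \<open>s\<close> is the number
  of constraints.
\<close>

definition obs_vector :: "nat \<Rightarrow> (nat \<Rightarrow> nat \<Rightarrow> 'a \<Rightarrow> bool) \<Rightarrow> nat \<Rightarrow> 'a \<Rightarrow> (nat \<Rightarrow> bool)" where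
  "obs_vector s Y n \<omega> = (\<lambda>l\<in>{1..s}. Y l n \<omega>)"

definition obs_family :: "nat \<Rightarrow> (nat \<Rightarrow> nat \<Rightarrow> 'a \<Rightarrow> bool) \<Rightarrow> 'a \<Rightarrow> (nat \<times> nat \<Rightarrow> bool)" where
  "obs_family s Y \<omega> = (\<lambda>(l, n)\<in>{1..s} \<times> {1..}. Y l n \<omega>)"

definition unif_family :: "(nat \<Rightarrow> 'a \<Rightarrow> real) \<Rightarrow> 'a \<Rightarrow> (nat \<Rightarrow> real)" where
  "unif_family U \<omega> = (\<lambda>n\<in>{1..}. U n \<omega>)"

abbreviation obs_vector_space :: "nat \<Rightarrow> (nat \<Rightarrow> bool) measure" where
  "obs_vector_space s \<equiv> PiM {1..s} (\<lambda>_. count_space UNIV)"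

abbreviation obs_family_space :: "nat \<Rightarrow> (nat \<times> nat \<Rightarrow> bool) measure" where
  "obs_family_space s \<equiv> PiM ({1..s} \<times> {1..}) (\<lambda>_. count_space UNIV)"

abbreviation unif_family_space :: "(nat \<Rightarrow> real) measure" where
  "unif_family_space \<equiv> PiM {1..} (\<lambda>_. borel)"

definition system_data ::
    "'a measure \<Rightarrow> nat \<Rightarrow> (nat \<Rightarrow> real) \<Rightarrow> (nat \<Rightarrow> nat \<Rightarrow> 'a \<Rightarrow> bool) \<Rightarrow> (nat \<Rightarrow> 'a \<Rightarrow> real) \<Rightarrow> bool" where
  "system_data M s p Y U \<longleftrightarrow>
     iid_vars M (obs_vector_space s) (obs_vector s Y) {1..} \<and>
     (\<forall>l\<in>{1..s}. 0 \<le> p l \<and> p l \<le> 1 \<and>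
        (\<forall>n\<ge>1. distr M (count_space UNIV) (Y l n) = measure_pmf (bernoulli_pmf (p l)))) \<and>
     iid_vars M borel U {1..} \<and>
     (\<forall>n\<ge>1. distr M borel (U n) = uniform_measure lborel {0<..<1}) \<and>
     indep_pair M (obs_family_space s) (obs_family s Y) unif_family_space (unif_family U)"

definition independent_systems ::
    "'a measure \<Rightarrow> nat \<Rightarrow> nat \<Rightarrow> (nat \<Rightarrow> nat \<Rightarrow> nat \<Rightarrow> 'a \<Rightarrow> bool) \<Rightarrow> (nat \<Rightarrow> nat \<Rightarrow> 'a \<Rightarrow> real) \<Rightarrow> bool" where
  "independent_systems M k s Y U \<longleftrightarrow>
     prob_space.indep_vars M (\<lambda>_. obs_family_space s \<Otimes>\<^sub>M unif_family_space)
       (\<lambda>i \<omega>. (obs_family s (Y i) \<omega>, unif_family (U i) \<omega>)) {1..k}"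


subsection \<open>Error allocation\<close>

text \<open>\<open>d u l\<close> is the number of thresholds considered on constraint \<open>l\<close> in pass \<open>u\<close>.\<close>

definition num_thresholds :: "nat \<Rightarrow> (nat \<Rightarrow> nat \<Rightarrow> nat) \<Rightarrow> nat \<Rightarrow> nat" where
  "num_thresholds w d l = (\<Sum>u=1..w. d u l)"

text \<open>
  A constraint with \<open>num_thresholds w d l = 0\<close> has no threshold in any pass, and the value assigned
  to it by the first allocation is never used.
\<close>

definition equal_alloc :: "real \<Rightarrow> nat \<Rightarrow> nat \<Rightarrow> (nat \<Rightarrow> nat \<Rightarrow> nat) \<Rightarrow> nat \<Rightarrow> real" where
  "equal_alloc \<beta> s w d l =
     (if num_thresholds w d l > 1 then \<beta> / (2 * real s) else \<beta> / real s)"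

definition weighted_alloc :: "real \<Rightarrow> nat \<Rightarrow> nat \<Rightarrow> (nat \<Rightarrow> nat \<Rightarrow> nat) \<Rightarrow> nat \<Rightarrow> real" where
  "weighted_alloc \<beta> s w d l = \<beta> / real (\<Sum>l'=1..s. min (num_thresholds w d l') 2)"

text \<open>
  The boundary is the smallest positive integer with the required property. Positivity is automatic
  when \<open>b < 1/2\<close>, see \<open>boundary_eq_Least_int\<close> below. For \<open>b \<ge> 1/2\<close> the property also holds for
  \<open>H = 0\<close>, where the two stopping regions \<open>S \<le> -H\<close> and \<open>S \<ge> H\<close> overlap.
\<close>

definition boundary :: "real \<Rightarrow> real \<Rightarrow> nat" where
  "boundary \<theta> b = (LEAST H. 1 \<le> H \<and> b \<ge> 1 / (1 + \<theta> ^ H))"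

lemma boundary_exists:
  fixes \<theta> b :: real
  assumes "\<theta> > 1" "b > 0"
  shows "\<exists>H\<ge>1. b \<ge> 1 / (1 + \<theta> ^ H)"
proof -
  obtain n where n: "1 / b < \<theta> ^ n"
    using real_arch_pow[OF assms(1)] by blast
  also have "\<theta> ^ n \<le> \<theta> ^ Suc n"
    using assms(1) by (intro power_increasing) auto
  finally have *: "1 / b \<le> 1 + \<theta> ^ Suc n"
    by simp
  have "0 < 1 + \<theta> ^ Suc n"
    using assms(1) by (intro add_pos_pos) auto
  with * assms(2) have "1 / (1 + \<theta> ^ Suc n) \<le> b"
    by (simp add: field_simps)
  then show ?thesis
    by (intro exI[of _ "Suc n"]) auto
qed

lemma boundary_eq_Least_int:
  fixes \<theta> b :: real
  assumes "\<theta> > 1" "0 < b" "b < 1 / 2"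
  shows "int (boundary \<theta> b) = (LEAST j::int. b \<ge> 1 / (1 + \<theta> powi j))"
proof (rule Least_equality[symmetric])
  have "1 \<le> boundary \<theta> b \<and> b \<ge> 1 / (1 + \<theta> ^ boundary \<theta> b)"
    unfolding boundary_def using boundary_exists[OF assms(1,2)] by (rule LeastI_ex)
  then show "b \<ge> 1 / (1 + \<theta> powi int (boundary \<theta> b))"
    by simp
next
  fix j :: int
  assume j: "b \<ge> 1 / (1 + \<theta> powi j)"
  have "j > 0"
  proof (rule ccontr)
    assume "\<not> j > 0"
    then have "\<theta> powi j \<le> \<theta> powi 0"
      using assms(1) by (intro power_int_increasing) auto
    moreover have "0 < \<theta> powi j"
      using assms(1) by simp
    ultimately have "1 / 2 \<le> 1 / (1 + \<theta> powi j)"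
      by (intro divide_left_mono) auto
    with j assms(3) show False
      by linarith
  qed
  then obtain m where m: "j = int m" "1 \<le> m"
    using zero_less_imp_eq_int by fastforce
  with j have "boundary \<theta> b \<le> m"
    unfolding boundary_def by (intro Least_le) auto
  with m show "int (boundary \<theta> b) \<le> j"
    by simp
qed


subsection \<open>Procedure\<close>

text \<open>
  \<open>Y n\<close> and \<open>U n\<close> are the observations of one system on one constraint and the uniform variables of
  that system; \<open>of_bool (U n \<omega> \<le> h)\<close> is the dummy Bernoulli variable for the threshold \<open>h\<close>.
\<close>

definition diff_sum :: "(nat \<Rightarrow> 'a \<Rightarrow> bool) \<Rightarrow> (nat \<Rightarrow> 'a \<Rightarrow> real) \<Rightarrow> real \<Rightarrow> 'a \<Rightarrow> nat \<Rightarrow> int" where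
  "diff_sum Y U h \<omega> r = (\<Sum>n=1..r. of_bool (Y n \<omega>) - of_bool (U n \<omega> \<le> h))"

definition exits :: "(nat \<Rightarrow> int) \<Rightarrow> nat \<Rightarrow> nat \<Rightarrow> bool" where
  "exits S H r \<longleftrightarrow> 1 \<le> r \<and> (S r \<le> - int H \<or> S r \<ge> int H)"

definition first_exit :: "(nat \<Rightarrow> int) \<Rightarrow> nat \<Rightarrow> nat \<Rightarrow> bool" where
  "first_exit S H r \<longleftrightarrow> exits S H r \<and> (\<forall>q<r. \<not> exits S H q)"

text \<open>If sampling never stops, the system is declared neither feasible nor infeasible.\<close>

definition declared_feasible :: "(nat \<Rightarrow> int) \<Rightarrow> nat \<Rightarrow> bool" where
  "declared_feasible S H \<longleftrightarrow> (\<exists>r. first_exit S H r \<and> S r \<le> - int H)"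

definition declared_infeasible :: "(nat \<Rightarrow> int) \<Rightarrow> nat \<Rightarrow> bool" where
  "declared_infeasible S H \<longleftrightarrow> (\<exists>r. first_exit S H r \<and> S r \<ge> int H)"


subsection \<open>Correct decision\<close>

text \<open>
  The odds ratios are extended reals: division of a positive number by 0 yields \<open>\<infinity>\<close>, so that a
  system with success probability 0 is desirable and one with success probability 1 is unacceptable.
\<close>

definition desirable :: "real \<Rightarrow> real \<Rightarrow> real \<Rightarrow> bool" where
  "desirable \<theta> p h \<longleftrightarrow> ereal ((1 - p) * h) / ereal (p * (1 - h)) \<ge> ereal \<theta>"

definition unacceptable :: "real \<Rightarrow> real \<Rightarrow> real \<Rightarrow> bool" where
  "unacceptable \<theta> p h \<longleftrightarrow> ereal (p * (1 - h)) / ereal ((1 - p) * h) \<ge> ereal \<theta>"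

definition correct_decision ::
    "real \<Rightarrow> real \<Rightarrow> nat \<Rightarrow> (nat \<Rightarrow> 'a \<Rightarrow> bool) \<Rightarrow> (nat \<Rightarrow> 'a \<Rightarrow> real) \<Rightarrow> real \<Rightarrow> 'a \<Rightarrow> bool" where
  "correct_decision \<theta> p H Y U h \<omega> \<longleftrightarrow>
     (desirable \<theta> p h \<longrightarrow> declared_feasible (diff_sum Y U h \<omega>) H) \<and>
     (unacceptable \<theta> p h \<longrightarrow> declared_infeasible (diff_sum Y U h \<omega>) H)"

lemma desirable_0: "0 < h \<Longrightarrow> desirable \<theta> 0 h"
  by (simp add: desirable_def)

lemma unacceptable_1: "h < 1 \<Longrightarrow> unacceptable \<theta> 1 h"
  by (simp add: unacceptable_def)

end

theory Submission
  imports Defs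
begin

text \<open>
  For one system, one constraint and one threshold \<open>h\<close>, the differences \<open>Y n - I n\<close> are independent
  steps in \<open>{-1, 0, 1}\<close>, going up with probability \<open>p * (1 - h)\<close> and down with probability
  \<open>(1 - p) * h\<close>. The procedure watches this walk leave the interval between \<open>- H\<close> and \<open>H\<close>, and the
  odds ratio in the definition of a desirable system is the ratio of the two step probabilities. A
  system is therefore desirable iff going down is at least \<open>\<theta>\<close> times as likely as going up. Then
  \<open>\<theta> powi S\<close> is a supermartingale, and stopping it at the exit bounds the probability of leaving at
  the wrong end by \<open>1 / (1 + \<theta> ^ H)\<close>, as in the gambler's ruin problem; the negative drift makes
  the walk leave almost surely (\<open>prob_not_declared_feasible\<close>). Unacceptable systems are the mirror
  image. The boundary \<open>H\<close> is chosen so that this bound is at most the error share of the constraint.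
  
  All thresholds of a constraint use the same uniform variables, so the walk for a larger threshold
  lies below the walk for a smaller one on every sample path. If the smallest desirable threshold is
  decided correctly, so are all desirable ones, and the largest unacceptable threshold likewise
  controls all unacceptable ones. However many thresholds there are, at most two error
  probabilities have to be paid for per constraint, and only one if the constraint has a single
  threshold (\<open>two_thresholds_suffice\<close>). This is what both allocations count, whence the errors of
  one system add up to at most \<open>\<beta>\<close> (\<open>alloc_sum_le\<close>, \<open>prob_system_correct\<close>); a union bound makes any
  dependence between the constraints harmless.
  
  For independent systems the probabilities multiply, and \<open>(1 - \<beta>) ^ k = 1 - \<alpha>\<close>; under arbitrary
  dependence a second union bound costs \<open>k * \<beta> = \<alpha>\<close>.
\<close>
section \<open>Exit of a lazy random walk with negative drift\<close>

lemma (in prob_space) expectation_finite_range: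
  fixes G :: "'b \<Rightarrow> real"
  assumes meas: "Z \<in> measurable M (count_space UNIV)"
    and fin: "finite A" and range: "\<And>\<omega>. \<omega> \<in> space M \<Longrightarrow> Z \<omega> \<in> A"
  shows "integrable M (\<lambda>\<omega>. G (Z \<omega>))"
    and "expectation (\<lambda>\<omega>. G (Z \<omega>)) = (\<Sum>x\<in>A. G x * prob {\<omega>\<in>space M. Z \<omega> = x})"
proof -
  have ev: "{\<omega>\<in>space M. Z \<omega> = x} \<in> events" for x
    using meas by measurable
  have eq: "G (Z \<omega>) = (\<Sum>x\<in>A. G x * indicat_real {\<omega>\<in>space M. Z \<omega> = x} \<omega>)"
    if "\<omega> \<in> space M" for \<omega>
  proof -
    have "(\<Sum>x\<in>A. G x * indicat_real {\<omega>\<in>space M. Z \<omega> = x} \<omega>)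
        = (\<Sum>x\<in>A. if Z \<omega> = x then G x else 0)"
      using that by (intro sum.cong) (auto simp: indicator_def)
    also have "\<dots> = G (Z \<omega>)"
      using fin range[OF that] by simp
    finally show ?thesis ..
  qed
  have int: "integrable M (\<lambda>\<omega>. G x * indicat_real {\<omega>\<in>space M. Z \<omega> = x} \<omega>)" for x
    using ev by (intro integrable_mult_right integrable_real_indicator) (auto simp: emeasure_eq_measure)
  have "integrable M (\<lambda>\<omega>. \<Sum>x\<in>A. G x * indicat_real {\<omega>\<in>space M. Z \<omega> = x} \<omega>)"
    using int by (intro Bochner_Integration.integrable_sum) auto
  then show "integrable M (\<lambda>\<omega>. G (Z \<omega>))"
    using eq by (simp cong: Bochner_Integration.integrable_cong)
  have "expectation (\<lambda>\<omega>. G (Z \<omega>))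
      = expectation (\<lambda>\<omega>. \<Sum>x\<in>A. G x * indicat_real {\<omega>\<in>space M. Z \<omega> = x} \<omega>)"
    using eq by (intro Bochner_Integration.integral_cong) auto
  also have "\<dots> = (\<Sum>x\<in>A. expectation (\<lambda>\<omega>. G x * indicat_real {\<omega>\<in>space M. Z \<omega> = x} \<omega>))"
    using int by (intro Bochner_Integration.integral_sum) auto
  also have "\<dots> = (\<Sum>x\<in>A. G x * prob {\<omega>\<in>space M. Z \<omega> = x})"
    using ev by (intro sum.cong) auto
  finally show "expectation (\<lambda>\<omega>. G (Z \<omega>)) = (\<Sum>x\<in>A. G x * prob {\<omega>\<in>space M. Z \<omega> = x})" .
qed

text \<open>
  The partial sums of \<open>x\<close>, frozen as soon as they reach \<open>H\<close> or \<open>- H\<close>. The recursion makes the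
  stopped walk a finite Markov chain, so that optional stopping becomes an induction on time.
\<close>
primrec stopped_walk :: "nat \<Rightarrow> (nat \<Rightarrow> int) \<Rightarrow> nat \<Rightarrow> int" where
  "stopped_walk H x 0 = 0"
| "stopped_walk H x (Suc r) =
     stopped_walk H x r + (if \<bar>stopped_walk H x r\<bar> < int H then x (Suc r) else 0)"

lemma stopped_walk_cong:
  assumes "\<And>n. n \<in> {1..r} \<Longrightarrow> x n = y n"
  shows "stopped_walk H x r = stopped_walk H y r"
  using assms by (induction r) auto

lemma stopped_walk_bound:
  assumes "\<And>n. \<bar>x n\<bar> \<le> 1"
  shows "\<bar>stopped_walk H x r\<bar> \<le> int H"
proof (induction r)
  case (Suc r)
  then show ?case using assms[of "Suc r"] by auto
qed simp

text \<open>
  The procedure tests for an exit from the first observation on, the recursion already at time 0.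
  Both agree because the walk starts strictly inside when \<open>1 \<le> H\<close>.
\<close>
lemma stopped_walk_cases:
  fixes x :: "nat \<Rightarrow> int"
  defines "S \<equiv> (\<lambda>r. \<Sum>n=1..r. x n)"
  assumes "1 \<le> H"
  shows "(stopped_walk H x r = S r \<and> (\<forall>q\<le>r. \<not> exits S H q)) \<or>
    (\<exists>t. first_exit S H t \<and> stopped_walk H x r = S t)"
proof (induction r)
  case 0
  then show ?case by (simp add: S_def exits_def)
next
  case (Suc r)
  then show ?case
  proof
    assume *: "stopped_walk H x r = S r \<and> (\<forall>q\<le>r. \<not> exits S H q)"
    have "\<bar>S r\<bar> < int H"
      using * assms(2) by (cases "r = 0") (auto simp: exits_def S_def)
    with * have eq: "stopped_walk H x (Suc r) = S (Suc r)"
      by (simp add: S_def)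
    show ?thesis
    proof (cases "exits S H (Suc r)")
      case True
      with * have "first_exit S H (Suc r)"
        by (auto simp: first_exit_def less_Suc_eq_le)
      with eq show ?thesis by blast
    next
      case False
      with * eq show ?thesis by (auto simp: le_Suc_eq)
    qed
  next
    assume "\<exists>t. first_exit S H t \<and> stopped_walk H x r = S t"
    then obtain t where t: "first_exit S H t" "stopped_walk H x r = S t" by blast
    then have "\<not> \<bar>S t\<bar> < int H"
      by (auto simp: first_exit_def exits_def)
    with t show ?thesis by auto
  qed
qed

lemma stopped_walk_lower_imp_declared_feasible:
  assumes "1 \<le> H" "stopped_walk H x r = - int H"
  shows "declared_feasible (\<lambda>r. \<Sum>n=1..r. x n) H"
proof -
  let ?S = "\<lambda>r. \<Sum>n=1..r. x n"
  have "\<not> (stopped_walk H x r = ?S r \<and> (\<forall>q\<le>r. \<not> exits ?S H q))"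
    using assms by (cases "r = 0") (auto simp: exits_def)
  then obtain t where "first_exit ?S H t" "?S t = - int H"
    using stopped_walk_cases[OF assms(1), of x r] assms(2) by auto
  then show ?thesis
    unfolding declared_feasible_def by (intro exI[of _ t]) simp
qed

locale lazy_walk = prob_space M for M :: "'a measure" +
  fixes X :: "nat \<Rightarrow> 'a \<Rightarrow> int" and u v :: real and H :: nat
  assumes indep: "indep_vars (\<lambda>_. count_space UNIV) X {1..}"
    and step: "\<And>n \<omega>. X n \<omega> \<in> {-1, 0, 1}"
    and prob_up: "\<And>n. 1 \<le> n \<Longrightarrow> prob {\<omega>\<in>space M. X n \<omega> = 1} = u"
    and prob_down: "\<And>n. 1 \<le> n \<Longrightarrow> prob {\<omega>\<in>space M. X n \<omega> = -1} = v"
    and H: "1 \<le> H"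
begin

definition stopped :: "nat \<Rightarrow> 'a \<Rightarrow> int" where
  "stopped r \<omega> = stopped_walk H (\<lambda>n. X n \<omega>) r"

lemma stopped_0: "stopped 0 \<omega> = 0"
  by (simp add: stopped_def)

lemma stopped_Suc: "stopped (Suc r) \<omega> = stopped r \<omega> + (if \<bar>stopped r \<omega>\<bar> < int H then X (Suc r) \<omega> else 0)"
  by (simp add: stopped_def)

lemma stopped_range: "stopped r \<omega> \<in> {- int H..int H}"
proof -
  have "\<bar>X n \<omega>\<bar> \<le> 1" for n
    using step[of n \<omega>] by auto
  then have "\<bar>stopped r \<omega>\<bar> \<le> int H"
    unfolding stopped_def by (rule stopped_walk_bound)
  then show ?thesis by auto
qed

lemma measurable_X: "1 \<le> n \<Longrightarrow> X n \<in> measurable M (count_space UNIV)"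
  using indep by (auto simp: indep_vars_def)

text \<open>
  The stopped walk at time \<open>r\<close> depends on the first \<open>r\<close> steps only.
\<close>
lemma indep_stopped_step:
  "indep_var (count_space UNIV) (stopped r) (count_space UNIV) (X (Suc r))"
proof -
  have sw: "(\<lambda>x. stopped_walk H x q) \<in> measurable (PiM {1..r} (\<lambda>_. count_space UNIV)) (count_space UNIV)"
    if "q \<le> r" for q
    using that
  proof (induction q)
    case (Suc q)
    have comp: "(\<lambda>x. x (Suc q)) \<in> measurable (PiM {1..r} (\<lambda>_. count_space UNIV)) (count_space (UNIV :: int set))"
      using Suc.prems by (intro measurable_component_singleton) auto
    have "(\<lambda>x. i + (if \<bar>i\<bar> < int H then x (Suc q) else 0))
        \<in> measurable (PiM {1..r} (\<lambda>_. count_space UNIV)) (count_space UNIV)" for i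
      by (rule measurable_compose[OF comp]) simp
    from measurable_compose_countable[OF this Suc.IH] Suc.prems show ?case by simp
  qed simp
  have "indep_var (PiM {1..r} (\<lambda>_. count_space UNIV)) (\<lambda>\<omega>. restrict (\<lambda>n. X n \<omega>) {1..r})
      (PiM {Suc r} (\<lambda>_. count_space UNIV)) (\<lambda>\<omega>. restrict (\<lambda>n. X n \<omega>) {Suc r})"
    by (rule indep_var_restrict[OF indep]) auto
  then have "indep_var (count_space UNIV) ((\<lambda>x. stopped_walk H x r) \<circ> (\<lambda>\<omega>. restrict (\<lambda>n. X n \<omega>) {1..r}))
      (count_space UNIV) ((\<lambda>x. x (Suc r)) \<circ> (\<lambda>\<omega>. restrict (\<lambda>n. X n \<omega>) {Suc r}))"
    by (rule indep_var_compose) (use sw in \<open>auto intro!: measurable_component_singleton\<close>)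
  moreover have "(\<lambda>x. stopped_walk H x r) \<circ> (\<lambda>\<omega>. restrict (\<lambda>n. X n \<omega>) {1..r}) = stopped r"
    by (rule ext) (auto simp: stopped_def intro!: stopped_walk_cong)
  moreover have "(\<lambda>x. x (Suc r)) \<circ> (\<lambda>\<omega>. restrict (\<lambda>n. X n \<omega>) {Suc r}) = X (Suc r)"
    by (rule ext) auto
  ultimately show ?thesis by simp
qed

lemma measurable_stopped [measurable]: "stopped r \<in> measurable M (count_space UNIV)"
  using indep_stopped_step[of r] by (rule indep_var_rv1)

lemma event_stopped: "{\<omega>\<in>space M. P (stopped r \<omega>)} \<in> events"
  using measurable_sets[OF measurable_stopped, of "Collect P" r] by (simp add: vimage_def Int_def conj_commute)

text \<open>
  Dynkin's formula for one step: the generator of the walk acts on \<open>V\<close> as long as the walk has not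
  been stopped. It is used with the exponential function for the end at which the walk leaves and
  with the identity for the time at which it leaves.
\<close>
lemma expectation_step:
  fixes V :: "int \<Rightarrow> real"
  shows "expectation (\<lambda>\<omega>. V (stopped (Suc r) \<omega>)) = expectation (\<lambda>\<omega>. V (stopped r \<omega>) +
    (if \<bar>stopped r \<omega>\<bar> < int H
     then u * (V (stopped r \<omega> + 1) - V (stopped r \<omega>)) + v * (V (stopped r \<omega> - 1) - V (stopped r \<omega>)) else 0))"
proof -
  let ?A = "{- int H..int H}" and ?B = "{-1, 0, 1 :: int}"
  define F where "F = (\<lambda>(x, j). V (x + (if \<bar>x\<bar> < int H then j else 0)))"
  let ?P = "\<lambda>x. prob {\<omega>\<in>space M. stopped r \<omega> = x}"
  let ?Q = "\<lambda>j. prob {\<omega>\<in>space M. X (Suc r) \<omega> = j}"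
  have [measurable]: "X (Suc r) \<in> measurable M (count_space UNIV)"
    by (rule measurable_X) simp
  have Q: "(\<Sum>j\<in>?B. ?Q j) = 1"
    using expectation_finite_range(2)[of "X (Suc r)" ?B "\<lambda>_. 1"] step prob_space by auto
  then have Q0: "?Q 0 = 1 - u - v"
    by (simp add: prob_up prob_down)
  have joint: "prob {\<omega>\<in>space M. (stopped r \<omega>, X (Suc r) \<omega>) = (x, j)} = ?P x * ?Q j" for x j
  proof -
    have "prob ((\<lambda>\<omega>. (stopped r \<omega>, X (Suc r) \<omega>)) -` ({x} \<times> {j}) \<inter> space M)
        = prob (stopped r -` {x} \<inter> space M) * prob (X (Suc r) -` {j} \<inter> space M)"
      by (rule indep_varD[OF indep_stopped_step]) auto
    then show ?thesis
      by (simp add: vimage_def Int_def conj_commute)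
  qed
  have "expectation (\<lambda>\<omega>. V (stopped (Suc r) \<omega>)) = expectation (\<lambda>\<omega>. F (stopped r \<omega>, X (Suc r) \<omega>))"
    by (simp add: F_def stopped_Suc)
  also have "\<dots> = (\<Sum>y\<in>?A \<times> ?B. F y * prob {\<omega>\<in>space M. (stopped r \<omega>, X (Suc r) \<omega>) = y})"
    using stopped_range[of r] step[of "Suc r"] by (intro expectation_finite_range(2)) auto
  also have "\<dots> = (\<Sum>x\<in>?A. \<Sum>j\<in>?B. F (x, j) * (?P x * ?Q j))"
    unfolding sum.cartesian_product using joint by (intro sum.cong) auto
  also have "\<dots> = (\<Sum>x\<in>?A. (V x +
      (if \<bar>x\<bar> < int H then u * (V (x + 1) - V x) + v * (V (x - 1) - V x) else 0)) * ?P x)"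
    by (intro sum.cong refl, simp add: F_def prob_up prob_down Q0) (simp add: algebra_simps)
  also have "\<dots> = expectation (\<lambda>\<omega>. V (stopped r \<omega>) +
    (if \<bar>stopped r \<omega>\<bar> < int H
     then u * (V (stopped r \<omega> + 1) - V (stopped r \<omega>)) + v * (V (stopped r \<omega> - 1) - V (stopped r \<omega>)) else 0))"
    using stopped_range[of r] by (intro expectation_finite_range(2)[symmetric]) auto
  finally show ?thesis .
qed

lemma integrable_stopped: "integrable M (\<lambda>\<omega>. V (stopped r \<omega>) :: real)"
  using stopped_range by (intro expectation_finite_range(1)[where A = "{- int H..int H}"]) auto

text \<open>
  Under the drift condition \<open>\<theta> powi x\<close> is superharmonic, so its expectation along the stopped walk
  stays at most 1, its value at the start. On the interval the function is at least \<open>1 / \<theta> ^ H\<close>,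
  and at the upper end it is \<open>\<theta> ^ H\<close>, which leaves room for only a small mass there. Counting the
  mass that is still inside with the least value of the function gives the bound at every finite
  time.
\<close>
lemma prob_upper:
  assumes \<theta>: "1 < \<theta>" and drift: "\<theta> * u \<le> v"
  shows "prob {\<omega>\<in>space M. stopped r \<omega> = int H} \<le> 1 / (1 + \<theta> ^ H)"
proof -
  let ?V = "\<lambda>x. \<theta> powi x"
  define a where "a = \<theta> ^ H"
  have V: "expectation (\<lambda>\<omega>. ?V (stopped r \<omega>)) \<le> 1"
  proof (induction r)
    case 0
    show ?case by (simp add: stopped_0 prob_space)
  next
    case (Suc r)
    have super: "u * (?V (x + 1) - ?V x) + v * (?V (x - 1) - ?V x) \<le> 0" for x
    proof -
      have "u * (?V (x + 1) - ?V x) + v * (?V (x - 1) - ?V x) = ?V x * (\<theta> - 1) / \<theta> * (\<theta> * u - v)"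
        using \<theta> by (simp add: power_int_add power_int_diff field_simps)
      also have "\<dots> \<le> 0"
        using \<theta> drift by (intro mult_nonneg_nonpos) auto
      finally show ?thesis .
    qed
    have "expectation (\<lambda>\<omega>. ?V (stopped (Suc r) \<omega>)) \<le> expectation (\<lambda>\<omega>. ?V (stopped r \<omega>))"
      unfolding expectation_step[of ?V]
    proof (rule integral_mono)
      show "integrable M (\<lambda>\<omega>. ?V (stopped r \<omega>) + (if \<bar>stopped r \<omega>\<bar> < int H then
        u * (?V (stopped r \<omega> + 1) - ?V (stopped r \<omega>)) + v * (?V (stopped r \<omega> - 1) - ?V (stopped r \<omega>)) else 0))"
        by (rule integrable_stopped)
      show "integrable M (\<lambda>\<omega>. ?V (stopped r \<omega>))"
        by (rule integrable_stopped)
    qed (use super in auto)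
    with Suc show ?case by simp
  qed
  have a: "1 < a"
    unfolding a_def using \<theta> H by (intro one_less_power) auto
  let ?q = "prob {\<omega>\<in>space M. stopped r \<omega> = int H}"
  \<comment> \<open>The integrand below is the minorant of \<open>\<theta> powi\<close> that is \<open>\<theta> ^ H\<close> at the upper end and \<open>\<theta> ^ (-H)\<close> elsewhere.\<close>
  have "1 / a + (a - 1 / a) * ?q
      = expectation (\<lambda>\<omega>. 1 / a + (a - 1 / a) * indicat_real {\<omega>\<in>space M. stopped r \<omega> = int H} \<omega>)"
    by (subst Bochner_Integration.integral_add) (auto simp: prob_space emeasure_eq_measure)
  also have "\<dots> \<le> expectation (\<lambda>\<omega>. ?V (stopped r \<omega>))"
  proof (rule integral_mono)
    fix \<omega>
    have "?V (- int H) \<le> ?V (stopped r \<omega>)"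
      using stopped_range[of r \<omega>] \<theta> by (intro power_int_increasing) auto
    then show "1 / a + (a - 1 / a) * indicat_real {\<omega>\<in>space M. stopped r \<omega> = int H} \<omega> \<le> ?V (stopped r \<omega>)"
      by (auto simp: indicator_def a_def power_int_minus divide_inverse)
  qed (auto intro!: integrable_stopped simp: emeasure_eq_measure)
  also note V
  finally have "(1 / a + (a - 1 / a) * ?q) * a \<le> 1 * a"
    using a by (intro mult_right_mono) auto
  then have "1 + (a\<^sup>2 - 1) * ?q \<le> a"
    using a by (simp add: algebra_simps power2_eq_square)
  then have "(a - 1) * ((1 + a) * ?q) \<le> (a - 1) * 1"
    by (simp add: algebra_simps power2_eq_square)
  then have "(1 + a) * ?q \<le> 1"
    using a by (simp only: mult_le_cancel_left_pos)
  then show ?thesis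
    unfolding a_def[symmetric] using a by (simp add: field_simps)
qed

text \<open>
  Every step made before the exit lowers the mean by \<open>v - u\<close>, but the mean never falls below \<open>- H\<close>.
  Hence the expected number of steps before the exit is bounded. The probabilities of being still
  inside decrease in time, so \<open>r\<close> times the last of them is at most the sum of the first \<open>r\<close>.
\<close>
lemma prob_inside:
  assumes "u < v"
  shows "real r * prob {\<omega>\<in>space M. \<bar>stopped r \<omega>\<bar> < int H} \<le> real H / (v - u)"
proof -
  let ?I = "\<lambda>r. {\<omega>\<in>space M. \<bar>stopped r \<omega>\<bar> < int H}"
  have [simp]: "?I r \<inter> space M = ?I r" for r
    by auto
  have "real r * prob (?I r) \<le> - expectation (\<lambda>\<omega>. real_of_int (stopped r \<omega>)) / (v - u)"
  proof (induction r)
    case 0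
    show ?case by (simp add: stopped_0)
  next
    case (Suc r)
    have "expectation (\<lambda>\<omega>. real_of_int (stopped (Suc r) \<omega>))
        = expectation (\<lambda>\<omega>. real_of_int (stopped r \<omega>) - (v - u) * indicat_real (?I r) \<omega>)"
      unfolding expectation_step[of real_of_int]
      by (intro Bochner_Integration.integral_cong) (auto simp: indicator_def)
    also have "\<dots> = expectation (\<lambda>\<omega>. real_of_int (stopped r \<omega>)) - (v - u) * prob (?I r)"
      by (subst Bochner_Integration.integral_diff)
        (auto intro!: integrable_stopped event_stopped simp: emeasure_eq_measure)
    finally have drop: "expectation (\<lambda>\<omega>. real_of_int (stopped (Suc r) \<omega>))
        = expectation (\<lambda>\<omega>. real_of_int (stopped r \<omega>)) - (v - u) * prob (?I r)" .
    have "- expectation (\<lambda>\<omega>. real_of_int (stopped (Suc r) \<omega>)) / (v - u)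
        = - expectation (\<lambda>\<omega>. real_of_int (stopped r \<omega>)) / (v - u) + prob (?I r)"
    proof -
      have "- (e - c * q) / c = - e / c + q" if "c \<noteq> 0" for e c q :: real
        using that by (simp add: field_simps)
      from this[of "v - u"] drop assms show ?thesis by simp
    qed
    moreover have "prob (?I (Suc r)) \<le> prob (?I r)"
      by (intro finite_measure_mono event_stopped) (auto simp: stopped_Suc split: if_splits)
    ultimately show ?case
      using Suc mult_left_mono[of "prob (?I (Suc r))" "prob (?I r)" "real r"]
      by (simp add: algebra_simps)
  qed
  also have "\<dots> \<le> real H / (v - u)"
  proof (intro divide_right_mono)
    have "expectation (\<lambda>\<omega>. - real_of_int (stopped r \<omega>)) \<le> expectation (\<lambda>\<omega>. real H)"
    proof (rule integral_mono)
      fix \<omega>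
      show "- real_of_int (stopped r \<omega>) \<le> real H"
        using stopped_range[of r \<omega>] by simp
    qed (auto intro: integrable_stopped)
    then show "- expectation (\<lambda>\<omega>. real_of_int (stopped r \<omega>)) \<le> real H"
      by (simp add: prob_space)
  qed (use assms in auto)
  finally show ?thesis .
qed

text \<open>
  If the lower end is not the exit, then at every time the walk is either still inside or stopped at
  the upper end. The first possibility has a probability of order \<open>1 / r\<close>.
\<close>
lemma prob_not_declared_feasible:
  assumes \<theta>: "1 < \<theta>" and drift: "\<theta> * u \<le> v" and "0 < v"
  shows "prob {\<omega>\<in>space M. \<not> declared_feasible (\<lambda>r. \<Sum>n=1..r. X n \<omega>) H} \<le> 1 / (1 + \<theta> ^ H)"
proof -
  have "0 \<le> u"
    using prob_up[of 1] by (metis le_refl measure_nonneg)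
  have "u < v"
  proof (cases "u = 0")
    case False
    with \<open>0 \<le> u\<close> \<theta> have "1 * u < \<theta> * u"
      by (intro mult_strict_right_mono) auto
    with drift show ?thesis by simp
  qed (use \<open>0 < v\<close> in simp)
  let ?E = "{\<omega>\<in>space M. \<not> declared_feasible (\<lambda>r. \<Sum>n=1..r. X n \<omega>) H}"
  have bound: "prob ?E \<le> real H / (v - u) / real r + 1 / (1 + \<theta> ^ H)" if "1 \<le> r" for r
  proof -
    have "?E \<subseteq> {\<omega>\<in>space M. \<bar>stopped r \<omega>\<bar> < int H} \<union> {\<omega>\<in>space M. stopped r \<omega> = int H}"
    proof
      fix \<omega> assume "\<omega> \<in> ?E"
      then have "stopped r \<omega> \<noteq> - int H" "\<omega> \<in> space M"
        using stopped_walk_lower_imp_declared_feasible[OF H] by (auto simp: stopped_def)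
      then show "\<omega> \<in> {\<omega>\<in>space M. \<bar>stopped r \<omega>\<bar> < int H} \<union> {\<omega>\<in>space M. stopped r \<omega> = int H}"
        using stopped_range[of r \<omega>] by auto
    qed
    then have "prob ?E \<le> prob ({\<omega>\<in>space M. \<bar>stopped r \<omega>\<bar> < int H} \<union> {\<omega>\<in>space M. stopped r \<omega> = int H})"
      by (intro finite_measure_mono) (auto intro!: sets.Un event_stopped)
    also have "\<dots> \<le> prob {\<omega>\<in>space M. \<bar>stopped r \<omega>\<bar> < int H} + prob {\<omega>\<in>space M. stopped r \<omega> = int H}"
      by (intro measure_Un_le event_stopped)
    also have "\<dots> \<le> real H / (v - u) / real r + 1 / (1 + \<theta> ^ H)"
      using prob_inside[OF \<open>u < v\<close>, of r] prob_upper[OF \<theta> drift, of r] that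
      by (intro add_mono) (auto simp: pos_le_divide_eq[of "real r"] mult.commute simp del: divide_divide_eq_left)
    finally show ?thesis .
  qed
  have "(\<lambda>r. real H / (v - u) / real r + 1 / (1 + \<theta> ^ H)) \<longlonglongrightarrow> 0 + 1 / (1 + \<theta> ^ H)"
    by (intro tendsto_add tendsto_const lim_const_over_n)
  then have "prob ?E \<le> 0 + 1 / (1 + \<theta> ^ H)"
    by (rule LIMSEQ_le_const) (use bound in blast)
  then show ?thesis by simp
qed

end

lemma (in lazy_walk) lazy_walk_uminus: "lazy_walk M (\<lambda>n \<omega>. - X n \<omega>) v u H"
proof
  show "indep_vars (\<lambda>_. count_space UNIV) (\<lambda>n \<omega>. - X n \<omega>) {1..}"
    by (rule indep_vars_compose2[OF indep]) simp
  show "- X n \<omega> \<in> {-1, 0, 1}" for n \<omega>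
    using step[of n \<omega>] by auto
qed (use prob_up prob_down H in \<open>auto simp: minus_equation_iff[of _ 1] minus_equation_iff[of _ "-1"]\<close>)

section \<open>The difference of observations and dummy variables as a lazy walk\<close>

text \<open>
  The steps of the walk combine an observation and a dummy variable with the same index. To see that
  such pairs are independent, both families are first joined to one independent family and then
  regrouped by the index.
\<close>
lemma (in prob_space) indep_vars_pair_index:
  assumes A: "indep_vars (\<lambda>_. N) (W True) I" and B: "indep_vars (\<lambda>_. N) (W False) I"
    and joint: "\<And>J K E F. finite J \<Longrightarrow> finite K \<Longrightarrow> J \<subseteq> I \<Longrightarrow> K \<subseteq> I \<Longrightarrow>
      (\<And>n. E n \<in> sets N) \<Longrightarrow> (\<And>n. F n \<in> sets N) \<Longrightarrow>
      prob {\<omega>\<in>space M. (\<forall>n\<in>J. W True n \<omega> \<in> E n) \<and> (\<forall>n\<in>K. W False n \<omega> \<in> F n)}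
      = prob {\<omega>\<in>space M. \<forall>n\<in>J. W True n \<omega> \<in> E n} * prob {\<omega>\<in>space M. \<forall>n\<in>K. W False n \<omega> \<in> F n}"
  shows "indep_vars (\<lambda>_. N) (\<lambda>(b, n). W b n) (UNIV \<times> I)"
proof -
  have prod: "prob {\<omega>\<in>space M. \<forall>n\<in>J. W b n \<omega> \<in> E n} = (\<Prod>n\<in>J. prob (W b n -` E n \<inter> space M))"
    if "finite J" "J \<subseteq> I" "\<And>n. E n \<in> sets N" for b J E
  proof (cases "J = {}")
    case False
    have "indep_vars (\<lambda>_. N) (W b) I"
      using A B by (cases b) auto
    then have "prob (\<Inter>n\<in>J. W b n -` E n \<inter> space M) = (\<Prod>n\<in>J. prob (W b n -` E n \<inter> space M))"
      using False that by (intro indep_varsD) auto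
    moreover have "(\<Inter>n\<in>J. W b n -` E n \<inter> space M) = {\<omega>\<in>space M. \<forall>n\<in>J. W b n \<omega> \<in> E n}"
      using False by auto
    ultimately show ?thesis by simp
  qed (simp add: prob_space)
  have rv: "W b n \<in> measurable M N" if "n \<in> I" for b n
    using A B that by (cases b) (auto simp: indep_vars_def)
  show ?thesis
    unfolding indep_vars_def2
  proof (intro conjI ballI indep_setsI)
    fix G and L :: "(bool \<times> 'b) set"
    assume L: "L \<noteq> {}" "L \<subseteq> UNIV \<times> I" "finite L"
      and G: "\<forall>j\<in>L. G j \<in> {(case j of (b, n) \<Rightarrow> W b n) -` A \<inter> space M |A. A \<in> sets N}"
    then have "\<forall>j. \<exists>E. E \<in> sets N \<and> (j \<in> L \<longrightarrow> G j = (case j of (b, n) \<Rightarrow> W b n) -` E \<inter> space M)"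
      by blast
    then obtain E where E: "\<And>j. E j \<in> sets N"
      "\<And>b n. (b, n) \<in> L \<Longrightarrow> G (b, n) = W b n -` E (b, n) \<inter> space M"
      by (metis (mono_tags, lifting) case_prod_conv)
    define J where "J b = {n. (b, n) \<in> L}" for b
    have J: "finite (J b)" "J b \<subseteq> I" for b
    proof -
      have "J b \<subseteq> snd ` L" by (force simp: J_def)
      then show "finite (J b)" using L(3) by (rule finite_surj[rotated])
      show "J b \<subseteq> I" using L by (auto simp: J_def)
    qed
    have L_eq: "L = Pair True ` J True \<union> Pair False ` J False"
    proof -
      have "(b, n) \<in> L \<longleftrightarrow> (b, n) \<in> Pair True ` J True \<union> Pair False ` J False" for b n
        by (cases b) (auto simp: J_def)
      then show ?thesis by auto
    qed
    have "(\<Inter>j\<in>L. G j) = {\<omega>\<in>space M. (\<forall>n\<in>J True. W True n \<omega> \<in> E (True, n)) \<and>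
        (\<forall>n\<in>J False. W False n \<omega> \<in> E (False, n))}" (is "_ = ?R")
    proof (intro equalityI subsetI)
      fix \<omega> assume *: "\<omega> \<in> (\<Inter>j\<in>L. G j)"
      then have **: "\<omega> \<in> space M \<and> W b n \<omega> \<in> E (b, n)" if "(b, n) \<in> L" for b n
        using E(2)[OF that] that by blast
      moreover obtain b n where "(b, n) \<in> L"
        using L(1) by auto
      ultimately show "\<omega> \<in> ?R" by (auto simp: J_def)
    next
      fix \<omega> assume "\<omega> \<in> ?R"
      then have "\<omega> \<in> G (b, n)" if "(b, n) \<in> L" for b n
        using that E(2)[OF that] by (cases b) (auto simp: J_def)
      then show "\<omega> \<in> (\<Inter>j\<in>L. G j)" by auto
    qed
    then have "prob (\<Inter>j\<in>L. G j) = (\<Prod>n\<in>J True. prob (W True n -` E (True, n) \<inter> space M)) *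
        (\<Prod>n\<in>J False. prob (W False n -` E (False, n) \<inter> space M))"
      using J E(1) by (simp add: joint prod)
    also have "\<dots> = (\<Prod>n\<in>J True. prob (G (True, n))) * (\<Prod>n\<in>J False. prob (G (False, n)))"
      using E(2) by (simp add: J_def)
    also have "\<dots> = (\<Prod>j\<in>L. prob (G j))"
      unfolding L_eq using J
      by (subst prod.union_disjoint) (auto simp: prod.reindex inj_on_def)
    finally show "prob (\<Inter>j\<in>L. G j) = (\<Prod>j\<in>L. prob (G j))" .
  qed (use rv in \<open>auto intro: measurable_sets\<close>)
qed

context prob_space
begin

context
  fixes s p Y U
  assumes data: "system_data M s p Y U"
begin

lemma indep_uniforms: "indep_vars (\<lambda>_. borel) U {1..}"
  using data by (simp add: system_data_def iid_vars_def)

lemma measurable_uniform: "1 \<le> n \<Longrightarrow> U n \<in> borel_measurable M"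
  using indep_uniforms by (auto simp: indep_vars_def)

lemma prob_uniform:
  assumes "1 \<le> n" "0 < h" "h < 1"
  shows "prob {\<omega>\<in>space M. U n \<omega> \<le> h} = h"
proof -
  have "{0<..<1} \<inter> {..h} = {0<..h}"
    using assms by auto
  then have "measure (uniform_measure lborel {0<..<1::real}) {..h} = h"
    using assms by (subst measure_uniform_measure) auto
  then have "measure (distr M borel (U n)) {..h} = h"
    using data assms by (simp add: system_data_def)
  then show ?thesis
    using measurable_uniform[OF assms(1)]
    by (simp add: measure_distr vimage_def Int_def conj_commute)
qed

context
  fixes l
  assumes l: "l \<in> {1..s}"
begin

lemma indep_observations: "indep_vars (\<lambda>_. count_space UNIV) (Y l) {1..}"
proof -
  have "indep_vars (\<lambda>_. count_space UNIV) (\<lambda>n \<omega>. obs_vector s Y n \<omega> l) {1..}"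
    using data l unfolding system_data_def iid_vars_def
    by (intro indep_vars_compose2[where Y = "\<lambda>_ y. y l" and M' = "\<lambda>_. obs_vector_space s"]
      measurable_component_singleton) auto
  then show ?thesis
    using l by (simp add: obs_vector_def)
qed

lemma measurable_observation: "1 \<le> n \<Longrightarrow> Y l n \<in> measurable M (count_space UNIV)"
  using indep_observations by (auto simp: indep_vars_def)

text \<open>
  The independence of the two families is an assumption about infinite sequences of vectors; joining
  the families requires it for finitely many coordinates only.
\<close>
lemma prob_observations_uniforms:
  assumes "finite J" "finite K" and JK: "J \<subseteq> {1..}" "K \<subseteq> {1..}" and F: "\<And>n. F n \<in> sets borel"
  shows "prob {\<omega>\<in>space M. (\<forall>n\<in>J. Y l n \<omega> \<in> E n) \<and> (\<forall>n\<in>K. U n \<omega> \<in> F n)}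
    = prob {\<omega>\<in>space M. \<forall>n\<in>J. Y l n \<omega> \<in> E n} * prob {\<omega>\<in>space M. \<forall>n\<in>K. U n \<omega> \<in> F n}"
proof -
  let ?A = "{y\<in>space (obs_family_space s). \<forall>n\<in>J. y (l, n) \<in> E n}"
  let ?B = "{x\<in>space unif_family_space. \<forall>n\<in>K. x n \<in> F n}"
  have pair: "indep_pair M (obs_family_space s) (obs_family s Y) unif_family_space (unif_family U)"
    using data by (simp add: system_data_def)
  have "{y\<in>space (obs_family_space s). y (l, n) \<in> E n} \<in> sets (obs_family_space s)" if "n \<in> J" for n
  proof -
    have "(\<lambda>y. y (l, n)) \<in> measurable (obs_family_space s) (count_space UNIV)"
      using that l JK by (intro measurable_component_singleton) auto
    from measurable_sets[OF this, of "E n"] show ?thesis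
      by (simp add: vimage_def Int_def conj_commute)
  qed
  then have A: "?A \<in> sets (obs_family_space s)"
    using \<open>finite J\<close> by (intro sets.sets_Collect_finite_All) auto
  have "{x\<in>space unif_family_space. x n \<in> F n} \<in> sets unif_family_space" if "n \<in> K" for n
  proof -
    have "(\<lambda>x. x n) \<in> measurable unif_family_space borel"
      using that JK by (intro measurable_component_singleton) auto
    from measurable_sets[OF this F, of n] show ?thesis
      by (simp add: vimage_def Int_def conj_commute)
  qed
  then have B: "?B \<in> sets unif_family_space"
    using \<open>finite K\<close> by (intro sets.sets_Collect_finite_All) auto
  have Y: "obs_family s Y -` ?A \<inter> space M = {\<omega>\<in>space M. \<forall>n\<in>J. Y l n \<omega> \<in> E n}"
  proof -
    have "obs_family s Y \<omega> (l, n) = Y l n \<omega>" if "n \<in> J" for \<omega> n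
      using that l JK by (auto simp: obs_family_def)
    moreover have "obs_family s Y \<omega> \<in> space (obs_family_space s)" for \<omega>
      by (simp add: obs_family_def space_PiM)
    ultimately show ?thesis by auto
  qed
  have U: "unif_family U -` ?B \<inter> space M = {\<omega>\<in>space M. \<forall>n\<in>K. U n \<omega> \<in> F n}"
  proof -
    have "unif_family U \<omega> n = U n \<omega>" if "n \<in> K" for \<omega> n
      using that JK by (auto simp: unif_family_def)
    moreover have "unif_family U \<omega> \<in> space unif_family_space" for \<omega>
      by (simp add: unif_family_def space_PiM)
    ultimately show ?thesis by auto
  qed
  have "prob ((obs_family s Y -` ?A \<inter> space M) \<inter> (unif_family U -` ?B \<inter> space M))
      = prob (obs_family s Y -` ?A \<inter> space M) * prob (unif_family U -` ?B \<inter> space M)"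
  proof (rule indep_setD)
    show "indep_set {obs_family s Y -` A \<inter> space M |A. A \<in> sets (obs_family_space s)}
        {unif_family U -` B \<inter> space M |B. B \<in> sets unif_family_space}"
      using pair by (simp only: indep_pair_def)
  qed (use A B in blast)+
  then show ?thesis
    unfolding Y U by (simp add: Int_def conj_commute conj_left_commute cong: conj_cong)
qed

lemma prob_observation:
  assumes "1 \<le> n"
  shows "prob {\<omega>\<in>space M. Y l n \<omega>} = p l"
proof -
  have "measure (distr M (count_space UNIV) (Y l n)) {True} = p l"
    using data l assms by (simp add: system_data_def measure_pmf_single)
  then show ?thesis
    using measurable_observation[OF assms]
    by (simp add: measure_distr vimage_def Int_def conj_commute)
qed

lemma lazy_walk_diff_sum:
  assumes h: "0 < h" "h < 1" and "1 \<le> H"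
  shows "lazy_walk M (\<lambda>n \<omega>. of_bool (Y l n \<omega>) - of_bool (U n \<omega> \<le> h))
    (p l * (1 - h)) ((1 - p l) * h) H"
proof
  \<comment> \<open>The dummy variables rather than the uniform ones, so that both families have values in \<open>bool\<close>.\<close>
  let ?W = "\<lambda>b n \<omega>. if b then Y l n \<omega> else U n \<omega> \<le> h"
  have V: "indep_vars (\<lambda>_. count_space UNIV) (\<lambda>n \<omega>. U n \<omega> \<le> h) {1..}"
    by (rule indep_vars_compose2[OF indep_uniforms, where Y = "\<lambda>_ u. u \<le> h"]) measurable
  have W: "indep_vars (\<lambda>_. count_space UNIV) (\<lambda>(b, n). ?W b n) (UNIV \<times> {1..})"
  proof (rule indep_vars_pair_index)
    fix J K :: "nat set" and E F :: "nat \<Rightarrow> bool set"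
    assume JK: "finite J" "finite K" "J \<subseteq> {1..}" "K \<subseteq> {1..}"
    have "{u. (u \<le> h) \<in> F n} \<in> sets borel" for n
      by measurable
    from prob_observations_uniforms[OF JK this, of E]
    show "prob {\<omega>\<in>space M. (\<forall>n\<in>J. ?W True n \<omega> \<in> E n) \<and> (\<forall>n\<in>K. ?W False n \<omega> \<in> F n)}
      = prob {\<omega>\<in>space M. \<forall>n\<in>J. ?W True n \<omega> \<in> E n} * prob {\<omega>\<in>space M. \<forall>n\<in>K. ?W False n \<omega> \<in> F n}"
      by simp
  qed (use indep_observations V in simp_all)
  have "indep_vars (\<lambda>n. PiM (UNIV \<times> {n}) (\<lambda>_. count_space UNIV))
      (\<lambda>n \<omega>. restrict (\<lambda>j. (case j of (b, n) \<Rightarrow> ?W b n) \<omega>) (UNIV \<times> {n})) {1..}"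
    by (rule indep_vars_restrict[OF W]) (auto simp: disjoint_family_on_def)
  then have "indep_vars (\<lambda>_. count_space UNIV) (\<lambda>n \<omega>. (\<lambda>x. of_bool (x (True, n)) - of_bool (x (False, n)) :: int)
      (restrict (\<lambda>j. (case j of (b, n) \<Rightarrow> ?W b n) \<omega>) (UNIV \<times> {n}))) {1..}"
  proof (rule indep_vars_compose2)
    fix n
    have [measurable]: "(\<lambda>x. x (b, n)) \<in> measurable (PiM (UNIV \<times> {n}) (\<lambda>_. count_space UNIV))
        (count_space (UNIV :: bool set))" for b :: bool
      by (intro measurable_component_singleton) auto
    show "(\<lambda>x. of_bool (x (True, n)) - of_bool (x (False, n)) :: int)
        \<in> measurable (PiM (UNIV \<times> {n}) (\<lambda>_. count_space UNIV)) (count_space UNIV)"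
      unfolding of_bool_def by measurable
  qed
  then show "indep_vars (\<lambda>_. count_space UNIV) (\<lambda>n \<omega>. of_bool (Y l n \<omega>) - of_bool (U n \<omega> \<le> h) :: int) {1..}"
    by simp
next
  fix n :: nat assume n: "1 \<le> n"
  note [measurable] = measurable_observation[OF n] measurable_uniform[OF n]
  note joint = prob_observations_uniforms[of "{n}" "{n}" "\<lambda>_. {h<..}" "\<lambda>_. {True}"]
    prob_observations_uniforms[of "{n}" "{n}" "\<lambda>_. {..h}" "\<lambda>_. {False}"]
  have nY: "prob {\<omega>\<in>space M. \<not> Y l n \<omega>} = 1 - p l"
    using prob_neg[of "\<lambda>\<omega>. Y l n \<omega>"] prob_observation[OF n] by simp
  have nU: "prob {\<omega>\<in>space M. h < U n \<omega>} = 1 - h"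
    using prob_neg[of "\<lambda>\<omega>. U n \<omega> \<le> h"] prob_uniform[OF n h] by (simp add: not_le)
  have "{\<omega>\<in>space M. of_bool (Y l n \<omega>) - of_bool (U n \<omega> \<le> h) = (1::int)} = {\<omega>\<in>space M. Y l n \<omega> \<and> h < U n \<omega>}"
    by auto
  then show "prob {\<omega>\<in>space M. of_bool (Y l n \<omega>) - of_bool (U n \<omega> \<le> h) = (1::int)} = p l * (1 - h)"
    using joint(1) n prob_observation[OF n] nU by simp
  have "{\<omega>\<in>space M. of_bool (Y l n \<omega>) - of_bool (U n \<omega> \<le> h) = (-1::int)} = {\<omega>\<in>space M. \<not> Y l n \<omega> \<and> U n \<omega> \<le> h}"
    by auto
  then show "prob {\<omega>\<in>space M. of_bool (Y l n \<omega>) - of_bool (U n \<omega> \<le> h) = (-1::int)} = (1 - p l) * h"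
    using joint(2) n nY prob_uniform[OF n h] by simp
qed (use \<open>1 \<le> H\<close> in auto)

end

end

end

section \<open>Decisions on one constraint\<close>

text \<open>
  Reflecting the path reduces every question about infeasibility to one about feasibility.
\<close>
lemma declared_infeasible_uminus:
  "declared_infeasible S H \<longleftrightarrow> declared_feasible (\<lambda>r. - S r) H"
proof -
  have "exits (\<lambda>r. - S r) H = exits S H"
    by (auto simp: exits_def fun_eq_iff)
  then show ?thesis
    by (simp add: declared_infeasible_def declared_feasible_def first_exit_def)
qed

text \<open>
  Until the upper path exits at the bottom it stays below \<open>H\<close>, hence so does the lower path. The
  lower path therefore cannot leave at the top first, and it is at the bottom no later than the
  upper one.
\<close>
lemma declared_feasible_antimono:
  assumes le: "\<And>r. S' r \<le> S r" and "declared_feasible S H"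
  shows "declared_feasible S' H"
proof -
  obtain t where t: "first_exit S H t" "S t \<le> - int H"
    using assms(2) by (auto simp: declared_feasible_def)
  then have t': "exits S' H t"
    using le[of t] by (auto simp: first_exit_def exits_def)
  define q where "q = (LEAST q. exits S' H q)"
  have q: "exits S' H q" "q \<le> t" "\<forall>j<q. \<not> exits S' H j"
    unfolding q_def using t' by (auto intro: LeastI Least_le dest: not_less_Least)
  have "S' q \<le> - int H"
  proof (cases "q = t")
    case True
    then show ?thesis using t(2) le[of t] by simp
  next
    case False
    then have "\<not> exits S H q"
      using t(1) q(2) by (simp add: first_exit_def)
    with q(1) le[of q] show ?thesis
      by (auto simp: exits_def)
  qed
  with q show ?thesis
    by (auto simp: declared_feasible_def first_exit_def)
qed

lemma diff_sum_antimono: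
  assumes "h \<le> h'"
  shows "diff_sum Y U h' \<omega> r \<le> diff_sum Y U h \<omega> r"
  unfolding diff_sum_def using assms by (intro sum_mono) (auto simp: of_bool_def)

text \<open>
  Clearing the denominator is sound although it vanishes for \<open>p = 0\<close>: the ratio is then infinite and
  the inequality on the right holds as well.
\<close>
lemma desirable_iff:
  assumes "0 \<le> p" "p \<le> 1" "0 < h" "h < 1" "1 < \<theta>"
  shows "desirable \<theta> p h \<longleftrightarrow> \<theta> * (p * (1 - h)) \<le> (1 - p) * h"
proof (cases "p = 0")
  case True
  then show ?thesis using assms by (simp add: desirable_0)
next
  case False
  with assms have "0 < p * (1 - h)" by simp
  then show ?thesis
    unfolding desirable_def using assms by (simp add: pos_le_divide_eq)
qed

lemma unacceptable_iff:
  assumes "0 \<le> p" "p \<le> 1" "0 < h" "h < 1" "1 < \<theta>"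
  shows "unacceptable \<theta> p h \<longleftrightarrow> \<theta> * ((1 - p) * h) \<le> p * (1 - h)"
proof (cases "p = 1")
  case True
  then show ?thesis using assms by (simp add: unacceptable_1)
next
  case False
  with assms have "0 < (1 - p) * h" by simp
  then show ?thesis
    unfolding unacceptable_def using assms by (simp add: pos_le_divide_eq)
qed

text \<open>
  Otherwise each of \<open>p * (1 - h)\<close> and \<open>(1 - p) * h\<close> would be at least \<open>\<theta> > 1\<close> times the other, so both
  would vanish, which they cannot do together.
\<close>
lemma not_desirable_and_unacceptable:
  assumes "0 \<le> p" "p \<le> 1" "0 < h" "h < 1" "1 < \<theta>"
  shows "\<not> (desirable \<theta> p h \<and> unacceptable \<theta> p h)"
proof
  define a b where "a = p * (1 - h)" and "b = (1 - p) * h"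
  assume "desirable \<theta> p h \<and> unacceptable \<theta> p h"
  then have le: "\<theta> * a \<le> b" "\<theta> * b \<le> a"
    using desirable_iff unacceptable_iff assms by (auto simp: a_def b_def)
  have nonneg: "0 \<le> a" "0 \<le> b"
    using assms by (auto simp: a_def b_def)
  have "1 * a \<le> \<theta> * a" "1 * b \<le> \<theta> * b"
    using nonneg assms by (intro mult_right_mono; simp)+
  with le have "a = b" by simp
  with le(1) nonneg \<open>1 < \<theta>\<close> have "a = 0"
    by (auto simp: mult_le_cancel_right2)
  with \<open>a = b\<close> assms show False
    by (auto simp: a_def b_def)
qed

text \<open>
  Larger thresholds give lower paths and are more easily desirable, so the smallest desirable
  threshold is the critical one among the desirable ones; dually for the largest unacceptable
  threshold. The set \<open>R\<close> consists of these two, as far as they exist. That it is a subset of \<open>T\<close>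
  matters as well: a single threshold then counts only once.
\<close>
lemma two_thresholds_suffice:
  assumes "finite T"
  obtains R where "R \<subseteq> T" "card R \<le> 2"
    "\<And>\<omega>. (\<forall>h\<in>R. correct_decision \<theta> p H Y U h \<omega>) \<Longrightarrow> (\<forall>h\<in>T. correct_decision \<theta> p H Y U h \<omega>)"
proof -
  define F where "F = {h\<in>T. desirable \<theta> p h}"
  define G where "G = {h\<in>T. unacceptable \<theta> p h}"
  define R where "R = (if F = {} then {} else {Min F}) \<union> (if G = {} then {} else {Max G})"
  have fin: "finite F" "finite G"
    using assms by (auto simp: F_def G_def)
  have MF: "Min F \<in> F" if "F \<noteq> {}" using fin that by simp
  have MG: "Max G \<in> G" if "G \<noteq> {}" using fin that by simp
  have "R \<subseteq> T"
    using MF MG by (auto simp: R_def F_def G_def)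
  moreover have "card R \<le> 2"
    unfolding R_def by (rule order_trans[OF card_Un_le]) auto
  moreover have "correct_decision \<theta> p H Y U h \<omega>"
    if R: "\<forall>h\<in>R. correct_decision \<theta> p H Y U h \<omega>" and h: "h \<in> T" for h \<omega>
    unfolding correct_decision_def
  proof (intro conjI impI)
    assume "desirable \<theta> p h"
    with h have hF: "h \<in> F" by (simp add: F_def)
    then have "Min F \<in> R" "desirable \<theta> p (Min F)"
      using MF by (auto simp: R_def F_def)
    with R have "declared_feasible (diff_sum Y U (Min F) \<omega>) H"
      by (auto simp: correct_decision_def)
    moreover have "Min F \<le> h"
      using fin hF by simp
    ultimately show "declared_feasible (diff_sum Y U h \<omega>) H"
      by (blast intro: declared_feasible_antimono diff_sum_antimono)
  next
    assume "unacceptable \<theta> p h"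
    with h have hG: "h \<in> G" by (simp add: G_def)
    then have "Max G \<in> R" "unacceptable \<theta> p (Max G)"
      using MG by (auto simp: R_def G_def)
    with R have "declared_feasible (\<lambda>r. - diff_sum Y U (Max G) \<omega> r) H"
      by (auto simp: correct_decision_def declared_infeasible_uminus)
    moreover have "h \<le> Max G"
      using fin hG by simp
    ultimately show "declared_infeasible (diff_sum Y U h \<omega>) H"
      unfolding declared_infeasible_uminus
      by (elim declared_feasible_antimono[rotated]) (simp add: diff_sum_antimono)
  qed
  ultimately show thesis using that by blast
qed

lemma measurable_diff_sum:
  assumes "\<And>n. 1 \<le> n \<Longrightarrow> Y n \<in> measurable N (count_space UNIV)"
    and "\<And>n. 1 \<le> n \<Longrightarrow> U n \<in> borel_measurable N"
  shows "(\<lambda>\<omega>. diff_sum Y U h \<omega> r) \<in> measurable N (count_space UNIV)"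
proof (induction r)
  case 0
  show ?case by (simp add: diff_sum_def)
next
  case (Suc r)
  note [measurable] = Suc assms[of "Suc r", simplified]
  have "(\<lambda>\<omega>. diff_sum Y U h \<omega> r + (of_bool (Y (Suc r) \<omega>) - of_bool (U (Suc r) \<omega> \<le> h)))
      \<in> measurable N (count_space UNIV)"
    unfolding of_bool_def by measurable
  then show ?case by (simp add: diff_sum_def)
qed

text \<open>
  The measurable space is arbitrary because for independent systems the event is needed on the space
  of the data of one system, not only on the sample space.
\<close>
lemma pred_correct_decision:
  assumes "\<And>n. 1 \<le> n \<Longrightarrow> Y n \<in> measurable N (count_space UNIV)"
    and "\<And>n. 1 \<le> n \<Longrightarrow> U n \<in> borel_measurable N"
  shows "Measurable.pred N (correct_decision \<theta> p H Y U h)"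
proof -
  have [measurable]: "Measurable.pred N (\<lambda>\<omega>. P (diff_sum Y U h \<omega> r))" for P r
    by (rule measurable_compose[OF measurable_diff_sum]) (use assms in auto)
  have "Measurable.pred N (\<lambda>\<omega>. correct_decision \<theta> p H Y U h \<omega>)"
    unfolding correct_decision_def declared_feasible_def declared_infeasible_def
      first_exit_def exits_def by measurable
  then show ?thesis .
qed

lemma (in prob_space) prob_incorrect_decision:
  assumes data: "system_data M s p Y U" and l: "l \<in> {1..s}"
    and \<theta>: "1 < \<theta>" and h: "0 < h" "h < 1" and H: "1 \<le> H"
  shows "prob {\<omega>\<in>space M. \<not> correct_decision \<theta> (p l) H (Y l) U h \<omega>} \<le> 1 / (1 + \<theta> ^ H)"
proof -
  have p: "0 \<le> p l" "p l \<le> 1"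
    using data l by (auto simp: system_data_def)
  interpret W: lazy_walk M "\<lambda>n \<omega>. of_bool (Y l n \<omega>) - of_bool (U n \<omega> \<le> h)"
    "p l * (1 - h)" "(1 - p l) * h" H
    using lazy_walk_diff_sum[OF data l h H] .
  interpret W': lazy_walk M "\<lambda>n \<omega>. - (of_bool (Y l n \<omega>) - of_bool (U n \<omega> \<le> h))"
    "(1 - p l) * h" "p l * (1 - h)" H
    by (rule W.lazy_walk_uminus)
  have S: "diff_sum (Y l) U h \<omega> = (\<lambda>r. \<Sum>n=1..r. of_bool (Y l n \<omega>) - of_bool (U n \<omega> \<le> h))" for \<omega>
    by (simp add: diff_sum_def fun_eq_iff)
  have S': "(\<lambda>r. - diff_sum (Y l) U h \<omega> r) = (\<lambda>r. \<Sum>n=1..r. - (of_bool (Y l n \<omega>) - of_bool (U n \<omega> \<le> h)))" for \<omega>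
    by (simp only: S sum_negf)
  consider (des) "desirable \<theta> (p l) h" | (una) "unacceptable \<theta> (p l) h"
    | (acc) "\<not> desirable \<theta> (p l) h" "\<not> unacceptable \<theta> (p l) h" by blast
  then show ?thesis
  proof cases
    case des
    then have drift: "\<theta> * (p l * (1 - h)) \<le> (1 - p l) * h"
      using desirable_iff p h \<theta> by blast
    have "p l \<noteq> 1"
      using drift \<theta> h by (auto simp: mult_le_0_iff)
    then have pos: "0 < (1 - p l) * h"
      using p h by simp
    have "\<not> unacceptable \<theta> (p l) h"
      using not_desirable_and_unacceptable[OF p h \<theta>] des by blast
    with des have "{\<omega>\<in>space M. \<not> correct_decision \<theta> (p l) H (Y l) U h \<omega>}
        = {\<omega>\<in>space M. \<not> declared_feasible (\<lambda>r. \<Sum>n=1..r. of_bool (Y l n \<omega>) - of_bool (U n \<omega> \<le> h)) H}"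
      by (simp add: correct_decision_def S)
    then show ?thesis
      using W.prob_not_declared_feasible[OF \<theta> drift pos] by simp
  next
    case una
    then have drift: "\<theta> * ((1 - p l) * h) \<le> p l * (1 - h)"
      using unacceptable_iff p h \<theta> by blast
    have "p l \<noteq> 0"
      using drift \<theta> h by (auto simp: mult_le_0_iff)
    then have pos: "0 < p l * (1 - h)"
      using p h by simp
    have "\<not> desirable \<theta> (p l) h"
      using not_desirable_and_unacceptable[OF p h \<theta>] una by blast
    with una have "{\<omega>\<in>space M. \<not> correct_decision \<theta> (p l) H (Y l) U h \<omega>}
        = {\<omega>\<in>space M. \<not> declared_feasible (\<lambda>r. \<Sum>n=1..r. - (of_bool (Y l n \<omega>) - of_bool (U n \<omega> \<le> h))) H}"
      unfolding correct_decision_def declared_infeasible_uminus S' by simp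
    then show ?thesis
      using W'.prob_not_declared_feasible[OF \<theta> drift pos] by simp
  next
    case acc
    then show ?thesis using \<theta> by (simp add: correct_decision_def add_nonneg_nonneg)
  qed
qed

section \<open>Error allocation\<close>

lemma boundary_spec:
  assumes "1 < \<theta>" "0 < b"
  shows "1 \<le> boundary \<theta> b" "1 / (1 + \<theta> ^ boundary \<theta> b) \<le> b"
proof -
  have "1 \<le> boundary \<theta> b \<and> b \<ge> 1 / (1 + \<theta> ^ boundary \<theta> b)"
    unfolding boundary_def using boundary_exists[OF assms] by (rule LeastI_ex)
  then show "1 \<le> boundary \<theta> b" "1 / (1 + \<theta> ^ boundary \<theta> b) \<le> b"
    by auto
qed

context
  fixes \<beta> :: real and s w :: nat and d :: "nat \<Rightarrow> nat \<Rightarrow> nat" and b :: "nat \<Rightarrow> real"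
  assumes \<beta>: "0 < \<beta>"
    and alloc: "(\<forall>l\<in>{1..s}. b l = equal_alloc \<beta> s w d l) \<or> (\<forall>l\<in>{1..s}. b l = weighted_alloc \<beta> s w d l)"
begin

lemma alloc_pos:
  assumes "l \<in> {1..s}" "1 \<le> num_thresholds w d l"
  shows "0 < b l"
proof -
  have "min (num_thresholds w d l) 2 \<le> (\<Sum>l'=1..s. min (num_thresholds w d l') 2)"
    using assms by (intro member_le_sum) auto
  then have "0 < (\<Sum>l'=1..s. min (num_thresholds w d l') 2)"
    using assms by linarith
  then have "0 < weighted_alloc \<beta> s w d l"
    unfolding weighted_alloc_def using \<beta> by (intro divide_pos_pos) linarith+
  moreover have "0 < equal_alloc \<beta> s w d l"
    using assms \<beta> by (simp add: equal_alloc_def)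
  ultimately show ?thesis
    using alloc assms(1) by auto
qed

text \<open>
  A constraint spends its share once if it has one threshold and twice if it has more. The equal
  allocation halves the share in the second case, so that every constraint spends at most \<open>\<beta> / s\<close>;
  the weighted allocation divides \<open>\<beta>\<close> by the number of times that shares are spent altogether.
\<close>
lemma alloc_sum_le: "(\<Sum>l=1..s. real (min (num_thresholds w d l) 2) * b l) \<le> \<beta>"
  using alloc
proof
  assume b: "\<forall>l\<in>{1..s}. b l = equal_alloc \<beta> s w d l"
  have "real (min (num_thresholds w d l) 2) * equal_alloc \<beta> s w d l \<le> \<beta> / real s" for l
  proof -
    consider "num_thresholds w d l = 0" | "num_thresholds w d l = 1" | "2 \<le> num_thresholds w d l"
      by linarith
    then show ?thesis
      using \<beta> by cases (auto simp: equal_alloc_def)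
  qed
  then have "(\<Sum>l=1..s. real (min (num_thresholds w d l) 2) * b l) \<le> (\<Sum>l=1..s. \<beta> / real s)"
    using b by (intro sum_mono) auto
  also have "\<dots> \<le> \<beta>"
    using \<beta> by simp
  finally show ?thesis .
next
  let ?D = "\<Sum>l=1..s. min (num_thresholds w d l) 2"
  assume "\<forall>l\<in>{1..s}. b l = weighted_alloc \<beta> s w d l"
  then have "(\<Sum>l=1..s. real (min (num_thresholds w d l) 2) * b l)
      = (\<Sum>l=1..s. real (min (num_thresholds w d l) 2) * (\<beta> / real ?D))"
    by (intro sum.cong) (auto simp: weighted_alloc_def)
  also have "\<dots> = real ?D * (\<beta> / real ?D)"
    by (simp only: sum_distrib_right of_nat_sum)
  also have "\<dots> \<le> \<beta>"
    using \<beta> by (cases "?D = 0") (simp_all del: of_nat_sum)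
  finally show ?thesis .
qed

end

section \<open>All decisions on one system\<close>

definition system_correct ::
  "nat \<Rightarrow> (nat \<Rightarrow> real) \<Rightarrow> (nat \<Rightarrow> real set) \<Rightarrow> (nat \<Rightarrow> real) \<Rightarrow> (nat \<Rightarrow> nat) \<Rightarrow>
    (nat \<Rightarrow> nat \<Rightarrow> 'a \<Rightarrow> bool) \<Rightarrow> (nat \<Rightarrow> 'a \<Rightarrow> real) \<Rightarrow> 'a \<Rightarrow> bool" where
  "system_correct s \<theta> T p H Y U \<omega> \<longleftrightarrow>
     (\<forall>l\<in>{1..s}. \<forall>h\<in>T l. correct_decision (\<theta> l) (p l) (H l) (Y l) U h \<omega>)"

lemma pred_system_correct:
  assumes "\<And>l n. l \<in> {1..s} \<Longrightarrow> 1 \<le> n \<Longrightarrow> Y l n \<in> measurable N (count_space UNIV)"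
    and "\<And>n. 1 \<le> n \<Longrightarrow> U n \<in> borel_measurable N"
    and T: "\<And>l. l \<in> {1..s} \<Longrightarrow> finite (T l)"
  shows "Measurable.pred N (system_correct s \<theta> T p H Y U)"
proof -
  have "Measurable.pred N (\<lambda>\<omega>. \<forall>l\<in>{1..s}. \<forall>h\<in>T l. correct_decision (\<theta> l) (p l) (H l) (Y l) U h \<omega>)"
    using assms by (intro pred_intros_finite pred_correct_decision) auto
  then show ?thesis
    by (simp add: system_correct_def[abs_def])
qed

text \<open>
  A union bound over the constraints and over the critical thresholds of each.
\<close>
lemma (in prob_space) prob_system_correct:
  assumes data: "system_data M s p Y U"
    and \<theta>: "\<And>l. l \<in> {1..s} \<Longrightarrow> 1 < \<theta> l"
    and T: "\<And>l. l \<in> {1..s} \<Longrightarrow> finite (T l) \<and> T l \<subseteq> {0<..<1}"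
    and b: "\<And>l. l \<in> {1..s} \<Longrightarrow> T l \<noteq> {} \<Longrightarrow> 0 < b l"
    and budget: "(\<Sum>l=1..s. real (min (card (T l)) 2) * b l) \<le> \<beta>"
  shows "1 - \<beta> \<le> prob {\<omega>\<in>space M. system_correct s \<theta> T p (\<lambda>l. boundary (\<theta> l) (b l)) Y U \<omega>}"
proof -
  let ?H = "\<lambda>l. boundary (\<theta> l) (b l)"
  let ?C = "\<lambda>l h \<omega>. correct_decision (\<theta> l) (p l) (?H l) (Y l) U h \<omega>"
  note meas = measurable_observation[OF data] measurable_uniform[OF data]
  have "\<exists>R. R \<subseteq> T l \<and> card R \<le> 2 \<and> (\<forall>\<omega>. (\<forall>h\<in>R. ?C l h \<omega>) \<longrightarrow> (\<forall>h\<in>T l. ?C l h \<omega>))"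
    if "l \<in> {1..s}" for l
    using two_thresholds_suffice[of "T l" "\<theta> l" "p l" "?H l" "Y l" U] T[OF that] by metis
  then obtain R where R: "\<And>l. l \<in> {1..s} \<Longrightarrow> R l \<subseteq> T l" "\<And>l. l \<in> {1..s} \<Longrightarrow> card (R l) \<le> 2"
    "\<And>l \<omega>. l \<in> {1..s} \<Longrightarrow> (\<forall>h\<in>R l. ?C l h \<omega>) \<Longrightarrow> (\<forall>h\<in>T l. ?C l h \<omega>)"
    by metis
  have finR: "finite (R l)" if "l \<in> {1..s}" for l
    using R(1) T that finite_subset by blast
  have ev: "{\<omega>\<in>space M. \<not> ?C l h \<omega>} \<in> events" if "l \<in> {1..s}" for l h
  proof -
    have "Measurable.pred M (?C l h)"
      using meas that by (intro pred_correct_decision) auto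
    then show ?thesis by measurable
  qed
  have single: "prob {\<omega>\<in>space M. \<not> ?C l h \<omega>} \<le> b l" if "l \<in> {1..s}" "h \<in> T l" for l h
  proof -
    have "0 < b l" using b that by blast
    note B = boundary_spec[OF \<theta>[OF that(1)] this]
    have "prob {\<omega>\<in>space M. \<not> ?C l h \<omega>} \<le> 1 / (1 + \<theta> l ^ ?H l)"
      using T[OF that(1)] that B(1) \<theta> by (intro prob_incorrect_decision[OF data]) auto
    with B(2) show ?thesis by linarith
  qed
  have good: "{\<omega>\<in>space M. system_correct s \<theta> T p ?H Y U \<omega>} \<in> events"
  proof -
    have "Measurable.pred M (system_correct s \<theta> T p ?H Y U)"
      using meas T by (intro pred_system_correct) auto
    then show ?thesis by measurable
  qed
  have "{\<omega>\<in>space M. \<not> system_correct s \<theta> T p ?H Y U \<omega>}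
      \<subseteq> (\<Union>l\<in>{1..s}. \<Union>h\<in>R l. {\<omega>\<in>space M. \<not> ?C l h \<omega>})"
    using R(3) by (fastforce simp: system_correct_def)
  then have "prob {\<omega>\<in>space M. \<not> system_correct s \<theta> T p ?H Y U \<omega>}
      \<le> prob (\<Union>l\<in>{1..s}. \<Union>h\<in>R l. {\<omega>\<in>space M. \<not> ?C l h \<omega>})"
    using ev finR by (intro finite_measure_mono sets.finite_UN) auto
  also have "\<dots> \<le> (\<Sum>l=1..s. prob (\<Union>h\<in>R l. {\<omega>\<in>space M. \<not> ?C l h \<omega>}))"
    using ev finR by (intro measure_UNION_le sets.finite_UN) auto
  also have "\<dots> \<le> (\<Sum>l=1..s. real (min (card (T l)) 2) * b l)"
  proof (rule sum_mono)
    fix l assume l: "l \<in> {1..s}"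
    have "prob (\<Union>h\<in>R l. {\<omega>\<in>space M. \<not> ?C l h \<omega>}) \<le> (\<Sum>h\<in>R l. prob {\<omega>\<in>space M. \<not> ?C l h \<omega>})"
      using ev finR l by (intro measure_UNION_le) auto
    also have "\<dots> \<le> (\<Sum>h\<in>R l. b l)"
      using R(1) l single by (intro sum_mono) blast
    also have "\<dots> = real (card (R l)) * b l"
      by simp
    also have "\<dots> \<le> real (min (card (T l)) 2) * b l"
    proof (cases "T l = {}")
      case True
      then show ?thesis using R(1)[OF l] by simp
    next
      case False
      have "card (R l) \<le> card (T l)"
        using R(1) T l by (intro card_mono) auto
      then show ?thesis
        using R(2)[OF l] b[OF l False] by (intro mult_right_mono) auto
    qed
    finally show "prob (\<Union>h\<in>R l. {\<omega>\<in>space M. \<not> ?C l h \<omega>}) \<le> real (min (card (T l)) 2) * b l" .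
  qed
  also note budget
  finally show ?thesis
    using prob_neg[OF good] by simp
qed

section \<open>All decisions on all systems\<close>

text \<open>
  A decision depends only on the values of the data from index 1 on, which allows the event to be
  transported from the sample space to the space of the data of one system.
\<close>
lemma correct_decision_cong:
  assumes "\<And>n. 1 \<le> n \<Longrightarrow> Y n \<omega> = Y' n \<omega>'" "\<And>n. 1 \<le> n \<Longrightarrow> U n \<omega> = U' n \<omega>'"
  shows "correct_decision \<theta> p H Y U h \<omega> \<longleftrightarrow> correct_decision \<theta> p H Y' U' h \<omega>'"
proof -
  have "diff_sum Y U h \<omega> = diff_sum Y' U' h \<omega>'"
    using assms by (auto simp: diff_sum_def fun_eq_iff intro!: sum.cong)
  then show ?thesis
    by (simp add: correct_decision_def)
qed

theorem theorem2:
  fixes M :: "'a measure"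
    and k s w :: nat
    and \<alpha> \<beta> :: real
    and \<theta> \<beta>\<^sub>l :: "nat \<Rightarrow> real"
    and T :: "nat \<Rightarrow> real set"
    and d :: "nat \<Rightarrow> nat \<Rightarrow> nat"
    and p :: "nat \<Rightarrow> nat \<Rightarrow> real"
    and Y :: "nat \<Rightarrow> nat \<Rightarrow> nat \<Rightarrow> 'a \<Rightarrow> bool"
    and U :: "nat \<Rightarrow> nat \<Rightarrow> 'a \<Rightarrow> real"
  assumes "prob_space M"
    and "k \<ge> 2"
    and "0 < \<alpha>" "\<alpha> < 1"
    and "\<And>l. l \<in> {1..s} \<Longrightarrow> \<theta> l > 1"
    and "\<And>l. l \<in> {1..s} \<Longrightarrow> finite (T l) \<and> T l \<subseteq> {0<..<1}"
    and "w \<ge> 1"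
    and "\<And>l. l \<in> {1..s} \<Longrightarrow> d 1 l = card (T l)"
    and "\<And>i. i \<in> {1..k} \<Longrightarrow> system_data M s (p i) (Y i) (U i)"
    and "(independent_systems M k s Y U \<and> \<beta> = 1 - (1 - \<alpha>) powr (1 / real k)) \<or>
         \<beta> = \<alpha> / real k"
    and "(\<forall>l\<in>{1..s}. \<beta>\<^sub>l l = equal_alloc \<beta> s w d l) \<or>
         (\<forall>l\<in>{1..s}. \<beta>\<^sub>l l = weighted_alloc \<beta> s w d l)"
  shows "measure M {\<omega> \<in> space M. \<forall>i\<in>{1..k}. \<forall>l\<in>{1..s}. \<forall>h\<in>T l.
            correct_decision (\<theta> l) (p i l) (boundary (\<theta> l) (\<beta>\<^sub>l l)) (Y i l) (U i) h \<omega>}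
         \<ge> 1 - \<alpha>"
proof -
  interpret prob_space M by fact
  note k = assms(2) and \<alpha> = assms(3,4) and \<theta> = assms(5) and T = assms(6)
    and data = assms(9) and mode = assms(10) and alloc = assms(11)
  let ?H = "\<lambda>l. boundary (\<theta> l) (\<beta>\<^sub>l l)"
  let ?C = "\<lambda>i. system_correct s \<theta> T (p i) ?H (Y i) (U i)"
  have powr: "((1 - \<alpha>) powr (1 / real k)) ^ k = 1 - \<alpha>"
    using k \<alpha> by (simp add: powr_realpow[symmetric] powr_powr)
  have "(1 - \<alpha>) powr (1 / real k) < 1 powr (1 / real k)"
    using k \<alpha> by (intro powr_less_mono2) auto
  then have \<beta>: "0 < \<beta>"
    using mode k \<alpha> by auto
  have card_le: "card (T l) \<le> num_thresholds w d l" if "l \<in> {1..s}" for l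
  proof -
    have "d 1 l \<le> (\<Sum>u=1..w. d u l)"
      using \<open>w \<ge> 1\<close> by (intro member_le_sum) auto
    then show ?thesis
      using assms(8)[OF that] by (simp add: num_thresholds_def)
  qed
  have pos: "0 < \<beta>\<^sub>l l" if "l \<in> {1..s}" "T l \<noteq> {}" for l
  proof -
    have "1 \<le> card (T l)"
      using T that by (simp add: Suc_le_eq card_gt_0_iff)
    then show ?thesis
      using alloc_pos[OF \<beta> alloc that(1)] card_le[OF that(1)] by linarith
  qed
  have "(\<Sum>l=1..s. real (min (card (T l)) 2) * \<beta>\<^sub>l l)
      \<le> (\<Sum>l=1..s. real (min (num_thresholds w d l) 2) * \<beta>\<^sub>l l)"
  proof (rule sum_mono)
    fix l assume l: "l \<in> {1..s}"
    have nonneg: "0 \<le> \<beta>\<^sub>l l"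
      using alloc l \<beta> by (auto simp: equal_alloc_def weighted_alloc_def simp del: of_nat_sum)
    show "real (min (card (T l)) 2) * \<beta>\<^sub>l l \<le> real (min (num_thresholds w d l) 2) * \<beta>\<^sub>l l"
      using card_le[OF l] nonneg by (intro mult_right_mono) auto
  qed
  then have budget: "(\<Sum>l=1..s. real (min (card (T l)) 2) * \<beta>\<^sub>l l) \<le> \<beta>"
    using alloc_sum_le[OF \<beta> alloc] by linarith
  have system: "1 - \<beta> \<le> prob {\<omega>\<in>space M. ?C i \<omega>}" if "i \<in> {1..k}" for i
    by (rule prob_system_correct[OF data[OF that] \<theta> T pos budget])
  have ev: "{\<omega>\<in>space M. ?C i \<omega>} \<in> events" if "i \<in> {1..k}" for i
  proof -
    have "Measurable.pred M (?C i)"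
      using measurable_observation[OF data[OF that]] measurable_uniform[OF data[OF that]] T
      by (intro pred_system_correct) auto
    then show ?thesis by measurable
  qed
  have all: "{\<omega> \<in> space M. \<forall>i\<in>{1..k}. \<forall>l\<in>{1..s}. \<forall>h\<in>T l.
      correct_decision (\<theta> l) (p i l) (?H l) (Y i l) (U i) h \<omega>} = (\<Inter>i\<in>{1..k}. {\<omega>\<in>space M. ?C i \<omega>})"
  proof -
    have "1 \<in> {1..k}" using k by simp
    then show ?thesis unfolding system_correct_def by blast
  qed
  show ?thesis
    unfolding all using mode
  proof
    assume "\<beta> = \<alpha> / real k"
    have "prob (space M - (\<Inter>i\<in>{1..k}. {\<omega>\<in>space M. ?C i \<omega>}))
        = prob (\<Union>i\<in>{1..k}. space M - {\<omega>\<in>space M. ?C i \<omega>})"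
      by (rule arg_cong[where f = prob]) auto
    also have "\<dots> \<le> (\<Sum>i=1..k. prob (space M - {\<omega>\<in>space M. ?C i \<omega>}))"
      using ev by (intro measure_UNION_le) auto
    also have "\<dots> \<le> (\<Sum>i=1..k. \<beta>)"
    proof (rule sum_mono)
      fix i assume i: "i \<in> {1..k}"
      show "prob (space M - {\<omega>\<in>space M. ?C i \<omega>}) \<le> \<beta>"
        using system[OF i] by (simp only: prob_compl[OF ev[OF i]])
    qed
    also have "\<dots> = \<alpha>"
      using k \<open>\<beta> = \<alpha> / real k\<close> by simp
    finally show "1 - \<alpha> \<le> prob (\<Inter>i\<in>{1..k}. {\<omega>\<in>space M. ?C i \<omega>})"
      using ev k by (subst (asm) prob_compl) (auto intro!: sets.finite_INT)
  next
    assume indep: "independent_systems M k s Y U \<and> \<beta> = 1 - (1 - \<alpha>) powr (1 / real k)"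
    \<comment> \<open>The event of system \<open>i\<close> is the preimage under its data \<open>?z i\<close> of a set that is measurable in the data space \<open>?N\<close>.\<close>
    let ?N = "obs_family_space s \<Otimes>\<^sub>M unif_family_space"
    let ?z = "\<lambda>i \<omega>. (obs_family s (Y i) \<omega>, unif_family (U i) \<omega>)"
    define C' where "C' i = system_correct s \<theta> T (p i) ?H (\<lambda>l n z. fst z (l, n)) (\<lambda>n z. snd z n)" for i
    have C': "{z\<in>space ?N. C' i z} \<in> sets ?N" for i
    proof -
      have "(\<lambda>z. fst z (l, n)) \<in> measurable ?N (count_space UNIV)" if "l \<in> {1..s}" "1 \<le> n" for l n
        by (rule measurable_compose[OF measurable_fst measurable_component_singleton]) (use that in auto)
      moreover have "(\<lambda>z. snd z n) \<in> borel_measurable ?N" if "1 \<le> n" for n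
        by (rule measurable_compose[OF measurable_snd measurable_component_singleton]) (use that in auto)
      ultimately have "Measurable.pred ?N (C' i)"
        unfolding C'_def using T by (intro pred_system_correct) auto
      then show ?thesis by measurable
    qed
    have "C' i (?z i \<omega>) \<longleftrightarrow> ?C i \<omega>" for i \<omega>
      unfolding C'_def system_correct_def
      by (intro ball_cong refl correct_decision_cong) (auto simp: obs_family_def unif_family_def)
    moreover have "?z i \<omega> \<in> space ?N" for i \<omega>
      by (simp add: obs_family_def unif_family_def space_pair_measure space_PiM)
    ultimately have vimage: "?z i -` {z\<in>space ?N. C' i z} \<inter> space M = {\<omega>\<in>space M. ?C i \<omega>}" for i
      by auto
    have "1 - \<alpha> = (\<Prod>i=1..k. 1 - \<beta>)"
      using indep powr by simp
    also have "\<dots> \<le> (\<Prod>i=1..k. prob {\<omega>\<in>space M. ?C i \<omega>})"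
      using system indep by (intro prod_mono) auto
    also have "\<dots> = (\<Prod>i=1..k. prob (?z i -` {z\<in>space ?N. C' i z} \<inter> space M))"
      by (simp only: vimage)
    also have "\<dots> = prob (\<Inter>i\<in>{1..k}. ?z i -` {z\<in>space ?N. C' i z} \<inter> space M)"
      using indep k C' unfolding independent_systems_def
      by (intro indep_varsD_finite[symmetric]) auto
    also have "\<dots> = prob (\<Inter>i\<in>{1..k}. {\<omega>\<in>space M. ?C i \<omega>})"
      by (simp only: vimage)
    finally show "1 - \<alpha> \<le> prob (\<Inter>i\<in>{1..k}. {\<omega>\<in>space M. ?C i \<omega>})" .
  qed
qed


end
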